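(* Let $\alpha,\beta,N$ be real numbers with $\alpha\neq-1,-2,\dots$, let $\lambda(x)=x(x+\alpha+\beta+1)$ and let $(R_n)_n=(R_n^{\alpha,\beta,N})_n$ be the dual Hahn polynomials. The sequences $$\varepsilon_{n,1}=-1,\qquad \varepsilon_{n,2}=\frac{\beta+N-n+1}{\alpha+n},\qquad \varepsilon_{n,3}=\frac{N-n+1}{\alpha+n}$$ define three $\mathcal D$-operators $\mathcal D_1,\mathcal D_2,\mathcal D_3$ for the dual Hahn polynomials and the algebra $\mathcal A^\lambda$. More precisely, for $i=1,2,3$ the linear operator $\mathcal D_i$ on polynomials in $\lambda$ determined by $$\mathcal D_i(R_n)=\sum_{j=1}^n(-1)^{j+1}\varepsilon_{n,i}\,\varepsilon_{n-1,i}\cdots\varepsilon_{n-j+1,i}\,R_{n-j},\qquad n\ge0,$$ belongs to $\mathcal A^\lambda$, and \begin{align*} \mathcal{D}_1&=-\frac{(x+\alpha+1)(x+\alpha+\beta+1)}{(2x+\alpha+\beta+1)(2x+\alpha+\beta+2)}\Delta_x+\frac{x(x+\beta)}{(2x+\alpha+\beta)(2x+\alpha+\beta+1)}\nabla_x,\\ \mathcal{D}_2&=\frac{(x+\alpha+1)(N-x)}{(2x+\alpha+\beta+1)(2x+\alpha+\beta+2)}\Delta_x+\frac{(x+\beta)(x+\alpha+\beta+N+1)}{(2x+\alpha+\beta)(2x+\alpha+\beta+1)}\nabla_x,\\ \mathcal{D}_3&=\frac{(x+\alpha+\beta+1)(N-x)}{(2x+\alpha+\beta+1)(2x+\alpha+\beta+2)}\Delta_x+\frac{x(x+\alpha+\beta+N+1)}{(2x+\alpha+\beta)(2x+\alpha+\beta+1)}\nabla_x.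 \end{align*}
   Context: $(a)_k=a(a+1)\cdots(a+k-1)$, $(a)_0=1$. For $\alpha\ne-1,-2,\dots$ the dual Hahn polynomials are $$R_n^{\alpha,\beta,N}(\lambda)=\frac1{n!}\sum_{j=0}^n(-1)^j\frac{(-n)_j(-N+j)_{n-j}}{(\alpha+1)_j\,j!}\prod_{i=0}^{j-1}\bigl(\lambda-i(\alpha+\beta+1+i)\bigr),\quad n\ge0,$$ polynomials of degree $n$ in $\lambda$. $\mathbb P^\lambda=\{p(\lambda(x)): p \text{ a polynomial}\}$ is the ring of polynomials in $\lambda=\lambda(x)=x(x+\alpha+\beta+1)$. Operators act on $p\in\mathbb P^\lambda$ through $x$: $\mathfrak s_{x,j}(p)(x)=p(\lambda(x+j))$, $\Delta_x p=p(\lambda(x+1))-p(\lambda(x))$, $\nabla_xp=p(\lambda(x))-p(\lambda(x-1))$. $\mathcal A^\lambda$ is the algebra of all operators $T=\sum_{j=s}^rh_j\,\mathfrak s_{x,j}$, with integers $s\le r$ and $h_j$ rational functions of $x$, such that $T(\mathbb P^\lambda)\subset\mathbb P^\lambda$. $\mathcal D$-operators: given polynomials $(p_n)_n$ with $\deg_\lambda p_n=n$ that are eigenfunctions of an operator in $\mathcal A^\lambda$ (for dual Hahn polynomials, the standard second order difference operator with eigenvalues $n$), and a sequence of numbers $(\varepsilon_n)_n$, the operator defined by linearity from $\mathcal D(p_n)=\sum_{j=1}^n(-1)^{j+1}\varepsilon_n\cdots\varepsilon_{n-j+1}p_{n-j}$, $n\ge0$, is called a $\mathcal D$-operator (associated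 to $\mathcal A^\lambda$ and $(p_n)_n$) if $\mathcal D\in\mathcal A^\lambda$. *)

theory Defs
  imports
    "HOL-Computational_Algebra.Polynomial_Factorial"
begin

text \<open>
  Polynomials in \<open>\<lambda>\<close> are represented by elements \<open>p\<close> of \<open>real poly\<close>, whose indeterminate stands
  for \<open>\<lambda>\<close>; rational functions of \<open>x\<close> are elements of \<open>real poly fract\<close>. Since \<open>\<lambda>(x)\<close> is not
  constant, \<open>p\<close> is determined by the rational function \<open>p(\<lambda>(x))\<close>.
\<close>

definition dual_hahn :: "real \<Rightarrow> real \<Rightarrow> real \<Rightarrow> nat \<Rightarrow> real poly" where
  "dual_hahn \<alpha> \<beta> N n =
     smult (1 / fact n)
       (\<Sum>j=0..n.
          smult ((-1) ^ j * pochhammer (- real n) j * pochhammer (- N + real j) (n - j)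
                   / (pochhammer (\<alpha> + 1) j * fact j))
            (\<Prod>i<j. [: - (real i * (\<alpha> + \<beta> + 1 + real i)), 1 :]))"

definition rx :: "real poly fract" where
  "rx = to_fract [:0, 1:]"

definition rconst :: "real \<Rightarrow> real poly fract" where
  "rconst c = to_fract [:c:]"

text \<open>The polynomial \<open>\<lambda>(x) = x(x + \<alpha> + \<beta> + 1)\<close> in \<open>x\<close>.\<close>

definition lam :: "real \<Rightarrow> real \<Rightarrow> real poly" where
  "lam \<alpha> \<beta> = [:0, 1:] * [:\<alpha> + \<beta> + 1, 1:]"

text \<open>\<open>shift \<alpha> \<beta> j p\<close> is \<open>p(\<lambda>(x + j))\<close>; in particular \<open>shift \<alpha> \<beta> 0 p\<close> is \<open>p(\<lambda>(x))\<close>.\<close>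

definition shift :: "real \<Rightarrow> real \<Rightarrow> int \<Rightarrow> real poly \<Rightarrow> real poly fract" where
  "shift \<alpha> \<beta> j p = to_fract (pcompose p (pcompose (lam \<alpha> \<beta>) [:of_int j, 1:]))"

definition fwd_diff :: "real \<Rightarrow> real \<Rightarrow> real poly \<Rightarrow> real poly fract" where
  "fwd_diff \<alpha> \<beta> p = shift \<alpha> \<beta> 1 p - shift \<alpha> \<beta> 0 p"

definition bwd_diff :: "real \<Rightarrow> real \<Rightarrow> real poly \<Rightarrow> real poly fract" where
  "bwd_diff \<alpha> \<beta> p = shift \<alpha> \<beta> 0 p - shift \<alpha> \<beta> (-1) p"

definition poly_ring_lam :: "real \<Rightarrow> real \<Rightarrow> real poly fract set" where
  "poly_ring_lam \<alpha> \<beta> = {to_fract (pcompose p (lam \<alpha> \<beta>)) | p. True}"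

definition diff_algebra :: "real \<Rightarrow> real \<Rightarrow> (real poly \<Rightarrow> real poly fract) set" where
  "diff_algebra \<alpha> \<beta> =
     {T. (\<exists>(s::int) (r::int) (h :: int \<Rightarrow> real poly fract). s \<le> r \<and>
            (\<forall>p. T p = (\<Sum>j=s..r. h j * shift \<alpha> \<beta> j p))) \<and>
         (\<forall>p. T p \<in> poly_ring_lam \<alpha> \<beta>)}"

text \<open>
  \<open>D\<close> is the operator defined by linearity from the sequence \<open>\<epsilon>\<close>, acting on polynomials in \<open>\<lambda>\<close>.
\<close>

definition is_eps_operator ::
    "(nat \<Rightarrow> real poly) \<Rightarrow> (nat \<Rightarrow> real) \<Rightarrow> (real poly \<Rightarrow> real poly) \<Rightarrow> bool" where
  "is_eps_operator p \<epsilon> D \<longleftrightarrow>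
     Vector_Spaces.linear smult smult D \<and>
     (\<forall>n. D (p n) = (\<Sum>j=1..n. smult ((-1) ^ (j + 1) * (\<Prod>i<j. \<epsilon> (n - i))) (p (n - j))))"

text \<open>
  The standing requirements on the family are part of the notion: \<open>p n\<close> has degree \<open>n\<close> in \<open>\<lambda>\<close>, and
  it is an eigenfunction, with eigenvalue \<open>\<theta> n\<close>, of an operator \<open>L\<close> in the algebra. The eigenvalues
  are a parameter because otherwise \<open>L\<close> could be chosen as the identity; prescribing them determines
  \<open>L\<close>. For dual Hahn polynomials with \<open>\<theta> n = n\<close>, it is the standard second order operator.
\<close>

definition is_D_operator ::
    "real \<Rightarrow> real \<Rightarrow> (nat \<Rightarrow> real poly) \<Rightarrow> (nat \<Rightarrow> real) \<Rightarrow> (nat \<Rightarrow> real)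
      \<Rightarrow> (real poly \<Rightarrow> real poly) \<Rightarrow> bool" where
  "is_D_operator \<alpha> \<beta> p \<theta> \<epsilon> D \<longleftrightarrow>
     (\<forall>n. degree (p n) = n) \<and>
     (\<exists>L \<in> diff_algebra \<alpha> \<beta>. \<forall>n. L (p n) = rconst (\<theta> n) * shift \<alpha> \<beta> 0 (p n)) \<and>
     is_eps_operator p \<epsilon> D \<and>
     (\<lambda>q. shift \<alpha> \<beta> 0 (D q)) \<in> diff_algebra \<alpha> \<beta>"

end

theory Submission
  imports Defs
begin

text \<open>
  The difference operators are easiest to describe on a basis of factorial type, on which they merely
  lower the index. For a real \<open>\<delta>\<close> and \<open>s = \<alpha> + \<beta> + 1\<close> let
  \<open>U\<^sub>k(\<lambda>(x)) = (\<Prod>i<k. (x + \<delta> - i) (x + s - \<delta> + i))\<close>. Each factor is \<open>\<lambda>(x)\<close> plus a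
  constant, so \<open>U\<^sub>k\<close> is a polynomial of degree \<open>k\<close> in \<open>\<lambda>\<close>. Both differences of \<open>U\<^sub>k\<close> are multiples of
  \<open>U\<^sub>k\<^sub>-\<^sub>1\<close> by rational functions of \<open>x\<close>, and in the combinations of the theorem the denominators cancel:
  the first operator (with \<open>\<delta> = 0\<close>) sends \<open>U\<^sub>k\<^sub>+\<^sub>1\<close> to \<open>-(k + 1) (\<alpha> + k + 1) U\<^sub>k\<close>; the third (with
  \<open>\<delta> = 0\<close>) and the second (with \<open>\<delta> = \<beta>\<close>) send it to \<open>(k + 1) (N + \<delta> - k) U\<^sub>k\<close>. Hence they map
  polynomials in \<open>\<lambda>\<close> to polynomials in \<open>\<lambda>\<close>; see \<open>second_order_op_lam_basis_Suc\<close> and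
  \<open>second_order_op_descends\<close>.

  An operator \<open>D\<close> has the form prescribed by a sequence \<open>\<epsilon>\<close> if \<open>D R\<^sub>0 = 0\<close> and
  \<open>D R\<^sub>n\<^sub>+\<^sub>1 = \<epsilon>\<^sub>n\<^sub>+\<^sub>1 (R\<^sub>n - D R\<^sub>n)\<close> (\<open>eps_operator_if_recurrence\<close>). For \<open>\<delta> = 0\<close> the definition
  of the dual Hahn polynomials is an expansion in the \<open>U\<^sub>k\<close>, whose coefficients are, up to signs
  and weights, generalised binomial coefficients, and the recurrence becomes Pascal's rule for the
  first operator and a weighted form of it for the third.

  The second operator becomes accessible through a symmetry: the dual Hahn polynomials have an
  expansion of the same shape in the basis for \<open>\<delta> = \<beta>\<close>, with \<open>N + \<beta>\<close> in place of \<open>N\<close>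
  (\<open>hahn_expansion_symmetric\<close>). It corresponds to exchanging two of the parameters of the continuous
  dual Hahn polynomials, which are symmetric in all three. It holds because the second order operator
  with eigenvalues \<open>n\<close> has both expansions as eigenfunctions: it is triangular with distinct diagonal
  entries \<open>0, 1, 2, \<dots>\<close>, so an eigenfunction is determined by its degree and leading coefficient.

  Finally, an operator of the prescribed form is unique because the \<open>R\<^sub>n\<close> span all polynomials, so
  every such operator is the one constructed from the difference formula.
\<close>

section \<open>Polynomial sequences with one member in each degree\<close>

text \<open>
  The bound on the degree makes it possible to use properties that only the members up to some index
  have, such as the action of a triangular operator on a top coefficient.
\<close>

lemma degree_basis_induct:
  fixes p :: "nat \<Rightarrow> 'a::field poly"
  assumes deg: "\<And>k. degree (p k) = k" and lead: "\<And>k. coeff (p k) k \<noteq> 0"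
    and add: "\<And>q r. P q \<Longrightarrow> P r \<Longrightarrow> P (q + r)"
    and smult: "\<And>c q. P q \<Longrightarrow> P (smult c q)"
    and basis: "\<And>k. k \<le> n \<Longrightarrow> P (p k)"
    and q: "degree q \<le> n"
  shows "P q"
  using basis q
proof (induction n arbitrary: q)
  case 0
  have "q = smult (coeff q 0 / coeff (p 0) 0) (p 0)"
    using 0 deg[of 0] lead[of 0]
    by (intro poly_eqI) (auto simp: coeff_eq_0 split: nat.splits elim!: degree_eq_zeroE
        simp: coeff_pCons)
  then show ?case
    using smult[OF 0(1)[of 0]] by (metis le_refl)
next
  case (Suc n)
  define c where "c = coeff q (Suc n) / coeff (p (Suc n)) (Suc n)"
  define r where "r = q - smult c (p (Suc n))"
  have "coeff r i = 0" if "n < i" for i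
  proof (cases "i = Suc n")
    case True
    then show ?thesis
      by (simp add: r_def c_def lead)
  next
    case False
    then have "degree q < i" "degree (p (Suc n)) < i"
      using that Suc.prems deg[of "Suc n"] by auto
    then show ?thesis
      by (simp add: r_def coeff_eq_0)
  qed
  then have "degree r \<le> n"
    by (intro degree_le) auto
  then have "P r"
    using Suc by simp
  moreover have "P (smult c (p (Suc n)))"
    by (intro smult Suc.prems) simp
  ultimately have "P (r + smult c (p (Suc n)))"
    by (rule add)
  then show ?case
    by (simp add: r_def)
qed

lemma smult_sum_right:
  fixes f :: "'b \<Rightarrow> 'a::comm_semiring_0 poly"
  shows "smult c (\<Sum>i\<in>A. f i) = (\<Sum>i\<in>A. smult c (f i))"
  by (induction A rule: infinite_finite_induct) (simp_all add: smult_add_right)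

lemma linear_smult_iff:
  fixes D :: "real poly \<Rightarrow> real poly"
  shows "Vector_Spaces.linear smult smult D \<longleftrightarrow>
    (\<forall>p q. D (p + q) = D p + D q) \<and> (\<forall>c p. D (smult c p) = smult c (D p))"
proof -
  have "vector_space (smult :: real \<Rightarrow> real poly \<Rightarrow> real poly)"
    by unfold_locales (auto simp: smult_add_right smult_add_left)
  then show ?thesis
    by (simp add: Vector_Spaces.linear_iff)
qed

lemma linear_smult_sum:
  fixes D :: "real poly \<Rightarrow> real poly"
  assumes "Vector_Spaces.linear smult smult D"
  shows "D (\<Sum>i\<in>A. smult (c i) (p i)) = (\<Sum>i\<in>A. smult (c i) (D (p i)))"
proof -
  have "D 0 = 0"
    using assms linear_smult_iff[of D] by (metis smult_0_left)
  then show ?thesis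
    using assms unfolding linear_smult_iff
    by (induction A rule: infinite_finite_induct) simp_all
qed

lemma linear_eq_on_basis:
  fixes D E :: "real poly \<Rightarrow> real poly" and p :: "nat \<Rightarrow> real poly"
  assumes D: "Vector_Spaces.linear smult smult D" and E: "Vector_Spaces.linear smult smult E"
    and deg: "\<And>k. degree (p k) = k" and lead: "\<And>k. coeff (p k) k \<noteq> 0"
    and eq: "\<And>k. D (p k) = E (p k)"
  shows "D = E"
proof
  fix q
  show "D q = E q"
  proof (rule degree_basis_induct[where P = "\<lambda>q. D q = E q", OF deg lead _ _ eq order_refl])
    show "D (q + r) = E (q + r)" if "D q = E q" "D r = E r" for q r
      using D E that unfolding linear_smult_iff by simp
    show "D (smult c q) = E (smult c q)" if "D q = E q" for c q
      using D E that unfolding linear_smult_iff by simp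
  qed
qed

text \<open>
  Splitting off the term \<open>j = 1\<close> from the defining sum leaves \<open>-\<epsilon>\<^sub>n\<^sub>+\<^sub>1\<close> times the sum for \<open>n\<close>, which
  turns products of unbounded length into a one-step condition.
\<close>

lemma eps_operator_if_recurrence:
  assumes D: "Vector_Spaces.linear smult smult D"
    and D0: "D (p 0) = 0"
    and rec: "\<And>n. D (p (Suc n)) = smult (\<epsilon> (Suc n)) (p n - D (p n))"
  shows "is_eps_operator p \<epsilon> D"
proof -
  have "D (p n) = (\<Sum>j=1..n. smult ((-1) ^ (j + 1) * (\<Prod>i<j. \<epsilon> (n - i))) (p (n - j)))" for n
  proof (induction n)
    case 0
    show ?case by (simp add: D0)
  next
    case (Suc n)
    let ?t = "\<lambda>n j. smult ((-1) ^ (j + 1) * (\<Prod>i<j. \<epsilon> (n - i))) (p (n - j))"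
    have "(\<Sum>j=1..Suc n. ?t (Suc n) j) = (\<Sum>j=0..n. ?t (Suc n) (Suc j))"
      by (simp only: One_nat_def sum.shift_bounds_cl_Suc_ivl)
    also have "\<dots> = ?t (Suc n) 1 + (\<Sum>j=1..n. ?t (Suc n) (Suc j))"
      by (simp add: sum.atLeast_Suc_atMost)
    also have "(\<Sum>j=1..n. ?t (Suc n) (Suc j)) = (\<Sum>j=1..n. smult (- \<epsilon> (Suc n)) (?t n j))"
      by (intro sum.cong refl) (simp add: prod.lessThan_Suc_shift mult.left_commute del: prod.lessThan_Suc)
    also have "\<dots> = smult (- \<epsilon> (Suc n)) (D (p n))"
      by (simp only: Suc smult_sum_right)
    finally show ?case
      by (simp add: rec smult_diff_right)
  qed
  then show ?thesis
    using D by (simp add: is_eps_operator_def)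
qed

section \<open>Polynomials in \<open>\<lambda>\<close> as rational functions of \<open>x\<close>\<close>

lemma rconst_simps:
  "rconst (a + b) = rconst a + rconst b" "rconst (a - b) = rconst a - rconst b"
  "rconst (a * b) = rconst a * rconst b" "rconst (- a) = - rconst a"
  "rconst 0 = 0" "rconst 1 = 1"
  by (simp_all add: rconst_def flip: to_fract_add to_fract_diff to_fract_mult to_fract_uminus)
     (simp flip: one_pCons)

lemma rconst_of_nat [simp]: "rconst (real n) = of_nat n"
  by (induction n) (simp_all add: rconst_simps)

lemma rconst_numeral [simp]: "rconst (numeral k) = numeral k"
  using rconst_of_nat[of "numeral k"] by simp

lemma two_rx_plus_rconst_nonzero: "2 * rx + rconst c \<noteq> 0"
proof -
  have "2 * rx + rconst c = to_fract [:c, 2:]"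
    unfolding mult_2 rx_def rconst_def by (simp flip: to_fract_add)
  then show ?thesis
    by simp
qed

lemma shift_add: "shift \<alpha> \<beta> j (p + q) = shift \<alpha> \<beta> j p + shift \<alpha> \<beta> j q"
  by (simp add: shift_def pcompose_add)

lemma shift_smult: "shift \<alpha> \<beta> j (smult c p) = rconst c * shift \<alpha> \<beta> j p"
  by (simp add: shift_def pcompose_smult rconst_def flip: to_fract_mult)

lemma shift_mult: "shift \<alpha> \<beta> j (p * q) = shift \<alpha> \<beta> j p * shift \<alpha> \<beta> j q"
  by (simp add: shift_def pcompose_mult)

lemma shift_1: "shift \<alpha> \<beta> j 1 = 1"
  by (simp add: shift_def pcompose_1)

lemma shift_linear_factor:
  "shift \<alpha> \<beta> j [:c, 1:] =
     (rx + rconst (of_int j)) * (rx + rconst (of_int j) + rconst (\<alpha> + \<beta> + 1)) + rconst c"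
  unfolding shift_def rx_def rconst_def lam_def
  by (simp flip: to_fract_add to_fract_mult add: pcompose_mult pcompose_pCons algebra_simps)

lemma shift_0_inject: "shift \<alpha> \<beta> 0 p = shift \<alpha> \<beta> 0 q \<longleftrightarrow> p = q"
proof
  assume "shift \<alpha> \<beta> 0 p = shift \<alpha> \<beta> 0 q"
  then have "pcompose (p - q) (lam \<alpha> \<beta>) = 0"
    by (simp add: shift_def pcompose_diff)
  moreover have "degree (lam \<alpha> \<beta>) = 2"
    by (simp add: lam_def)
  ultimately show "p = q"
    using pcompose_eq_0[of "p - q" "lam \<alpha> \<beta>"] by auto
qed simp

lemma shift_0_in_poly_ring_lam: "shift \<alpha> \<beta> 0 q \<in> poly_ring_lam \<alpha> \<beta>"
  by (auto simp: shift_def poly_ring_lam_def)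

section \<open>Second order difference operators\<close>

definition second_order_op ::
    "real \<Rightarrow> real \<Rightarrow> real poly fract \<Rightarrow> real poly fract \<Rightarrow> real poly \<Rightarrow> real poly fract" where
  "second_order_op \<alpha> \<beta> A B q = A * fwd_diff \<alpha> \<beta> q + B * bwd_diff \<alpha> \<beta> q"

lemma second_order_op_add:
  "second_order_op \<alpha> \<beta> A B (p + q) = second_order_op \<alpha> \<beta> A B p + second_order_op \<alpha> \<beta> A B q"
  by (simp add: second_order_op_def fwd_diff_def bwd_diff_def shift_add algebra_simps)

lemma second_order_op_smult:
  "second_order_op \<alpha> \<beta> A B (smult c q) = rconst c * second_order_op \<alpha> \<beta> A B q"
  by (simp add: second_order_op_def fwd_diff_def bwd_diff_def shift_smult algebra_simps)

lemma second_order_op_in_diff_algebra: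
  assumes "\<And>q. shift \<alpha> \<beta> 0 (D q) = second_order_op \<alpha> \<beta> A B q"
  shows "(\<lambda>q. shift \<alpha> \<beta> 0 (D q)) \<in> diff_algebra \<alpha> \<beta>"
proof -
  \<comment> \<open>coefficients of the shifts by \<open>1\<close>, \<open>0\<close> and \<open>-1\<close> after expanding the differences\<close>
  define h :: "int \<Rightarrow> real poly fract"
    where "h j = (if j = 1 then A else if j = 0 then B - A else - B)" for j
  have "{-1..1} = {-1, 0, 1::int}"
    by auto
  then have "shift \<alpha> \<beta> 0 (D q) = (\<Sum>j=-1..1. h j * shift \<alpha> \<beta> j q)" for q
    by (simp add: assms second_order_op_def fwd_diff_def bwd_diff_def h_def algebra_simps)
  then show ?thesis
    unfolding diff_algebra_def mem_Collect_eq
    by (intro conjI exI[of _ "-1"] exI[of _ 1] exI[of _ h] allI shift_0_in_poly_ring_lam) auto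
qed

text \<open>
  Since \<open>q \<mapsto> q(\<lambda>(x))\<close> is injective and linear, it suffices to find polynomial values on a basis: the
  operator on all polynomials is then determined pointwise, and its linearity is inherited.
\<close>

lemma second_order_op_descends:
  assumes deg: "\<And>k. degree (p k) = k" and lead: "\<And>k. coeff (p k) k \<noteq> 0"
    and basis: "\<And>k. second_order_op \<alpha> \<beta> A B (p k) = shift \<alpha> \<beta> 0 (f k)"
  obtains D where "Vector_Spaces.linear smult smult D"
    and "\<And>q. shift \<alpha> \<beta> 0 (D q) = second_order_op \<alpha> \<beta> A B q"
    and "\<And>k. D (p k) = f k"
proof -
  have "\<exists>r. shift \<alpha> \<beta> 0 r = second_order_op \<alpha> \<beta> A B q" for q
  proof (rule degree_basis_induct[OF deg lead, of _ _ q, OF _ _ _ order_refl])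
    show "\<exists>r. shift \<alpha> \<beta> 0 r = second_order_op \<alpha> \<beta> A B (p k)" for k
      by (metis basis)
  next
    fix c q
    assume "\<exists>r. shift \<alpha> \<beta> 0 r = second_order_op \<alpha> \<beta> A B q"
    then show "\<exists>r. shift \<alpha> \<beta> 0 r = second_order_op \<alpha> \<beta> A B (smult c q)"
      by (metis second_order_op_smult shift_smult)
  next
    fix q1 q2
    assume "\<exists>r. shift \<alpha> \<beta> 0 r = second_order_op \<alpha> \<beta> A B q1"
      "\<exists>r. shift \<alpha> \<beta> 0 r = second_order_op \<alpha> \<beta> A B q2"
    then show "\<exists>r. shift \<alpha> \<beta> 0 r = second_order_op \<alpha> \<beta> A B (q1 + q2)"
      by (metis second_order_op_add shift_add)
  qed
  then obtain D where D: "shift \<alpha> \<beta> 0 (D q) = second_order_op \<alpha> \<beta> A B q" for q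
    by metis
  have "D (q + r) = D q + D r" "D (smult c q) = smult c (D q)" for q r c
    by (simp_all add: D second_order_op_add second_order_op_smult shift_add shift_smult
        flip: shift_0_inject[of \<alpha> \<beta>])
  then have "Vector_Spaces.linear smult smult D"
    by (simp add: linear_smult_iff)
  moreover have "D (p k) = f k" for k
    using D basis by (simp flip: shift_0_inject[of \<alpha> \<beta>])
  ultimately show ?thesis
    using that D by blast
qed

section \<open>Differences of quadratic factorial products\<close>

definition quad_fact :: "'a::comm_ring_1 \<Rightarrow> 'a \<Rightarrow> nat \<Rightarrow> 'a" where
  "quad_fact y \<sigma> k = (\<Prod>i<k. (y - of_nat i) * (y + \<sigma> + of_nat i))"

lemma quad_fact_0 [simp]: "quad_fact y \<sigma> 0 = 1"
  by (simp add: quad_fact_def)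

lemma quad_fact_Suc:
  "quad_fact y \<sigma> (Suc k) = quad_fact y \<sigma> k * ((y - of_nat k) * (y + \<sigma> + of_nat k))"
  by (simp add: quad_fact_def)

text \<open>
  The reflection \<open>y \<mapsto> -y - \<sigma>\<close> fixes \<open>y (y + \<sigma>)\<close> and exchanges forward and backward shifts.
\<close>

lemma quad_fact_reflect: "quad_fact (- y - \<sigma>) \<sigma> k = quad_fact y \<sigma> k"
  unfolding quad_fact_def by (intro prod.cong refl) (simp add: algebra_simps)

text \<open>
  Shifting \<open>y\<close> moves each of the two runs of consecutive factors by one place, so only the end factors
  change. The multiplier \<open>y + \<sigma>\<close> restores the factor that is lost at one end; it is also a factor of
  the forward coefficient of each operator below.
\<close>

lemma quad_fact_shift_up:
  "(y + \<sigma>) * quad_fact (y + 1) \<sigma> (Suc k) =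
     (y + 1) * (y + \<sigma> + of_nat k) * (y + \<sigma> + of_nat k + 1) * quad_fact y \<sigma> k"
proof (induction k)
  case 0
  show ?case by (simp add: quad_fact_Suc algebra_simps)
next
  case (Suc k)
  have "(y + \<sigma>) * quad_fact (y + 1) \<sigma> (Suc (Suc k)) =
     ((y + \<sigma>) * quad_fact (y + 1) \<sigma> (Suc k)) * ((y - of_nat k) * (y + \<sigma> + of_nat k + 2))"
    by (simp only: quad_fact_Suc[of _ _ "Suc k"]) (simp add: algebra_simps)
  also have "\<dots> = (y + 1) * (y + \<sigma> + of_nat k + 1) * (y + \<sigma> + of_nat k + 2) *
      (quad_fact y \<sigma> k * ((y - of_nat k) * (y + \<sigma> + of_nat k)))"
    unfolding Suc by (simp only: ac_simps)
  finally show ?case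
    by (simp only: quad_fact_Suc[of y]) (simp add: algebra_simps)
qed

lemma quad_fact_fwd_diff:
  "(y + \<sigma>) * (quad_fact (y + 1) \<sigma> (Suc k) - quad_fact y \<sigma> (Suc k)) =
     of_nat (Suc k) * (2 * y + \<sigma> + 1) * (y + \<sigma> + of_nat k) * quad_fact y \<sigma> k"
  unfolding right_diff_distrib quad_fact_shift_up quad_fact_Suc[of y]
  by (simp add: algebra_simps)

lemma quad_fact_bwd_diff:
  "y * (quad_fact y \<sigma> (Suc k) - quad_fact (y - 1) \<sigma> (Suc k)) =
     of_nat (Suc k) * (2 * y + \<sigma> - 1) * (y - of_nat k) * quad_fact y \<sigma> k"
proof -
  have "(- y - \<sigma>) + 1 = - (y - 1) - \<sigma>" "(- y - \<sigma>) + \<sigma> = - y"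
    "2 * (- y - \<sigma>) + \<sigma> + 1 = - (2 * y + \<sigma> - 1)" "- y + of_nat k = - (y - of_nat k)"
    by (simp_all add: algebra_simps)
  then have "- y * (quad_fact (y - 1) \<sigma> (Suc k) - quad_fact y \<sigma> (Suc k)) =
     of_nat (Suc k) * (- (2 * y + \<sigma> - 1)) * (- (y - of_nat k)) * quad_fact y \<sigma> k"
    using quad_fact_fwd_diff[of "- y - \<sigma>" \<sigma> k] by (simp only: quad_fact_reflect)
  then show ?thesis
    by (metis (no_types, lifting) minus_diff_eq minus_mult_minus mult_minus_left mult_minus_right)
qed

text \<open>
  The coefficients have poles at the zeros of \<open>2 y + \<sigma>\<close> and \<open>2 y + \<sigma> \<plusminus> 1\<close>. The last two
  cancel against the differences; the hypothesis on \<open>F\<close> and \<open>G\<close> is what makes the first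
  cancel between the two terms.
\<close>

lemma quad_fact_second_order:
  fixes y \<sigma> :: "'a::field"
  assumes nz: "2 * y + \<sigma> \<noteq> 0" "2 * y + \<sigma> + 1 \<noteq> 0" "2 * y + \<sigma> - 1 \<noteq> 0"
    and E: "F * (y + \<sigma> + of_nat k) + G * (y - of_nat k) = (2 * y + \<sigma>) * E"
  shows "(F * (y + \<sigma>)) / ((2 * y + \<sigma>) * (2 * y + \<sigma> + 1)) *
           (quad_fact (y + 1) \<sigma> (Suc k) - quad_fact y \<sigma> (Suc k))
         + (G * y) / ((2 * y + \<sigma> - 1) * (2 * y + \<sigma>)) *
           (quad_fact y \<sigma> (Suc k) - quad_fact (y - 1) \<sigma> (Suc k))
         = of_nat (Suc k) * E * quad_fact y \<sigma> k" (is "?f * ?df + ?b * ?db = _")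
proof -
  have cancel: "F * (n * c * u * g) / (d * c) = n * (F * u) * g / d" if "c \<noteq> 0"
    for F n c u g d :: 'a
  proof -
    have "F * (n * c * u * g) = n * (F * u) * g * c"
      by (simp only: ac_simps)
    then show ?thesis
      using that by simp
  qed
  have "?f * ?df = F * ((y + \<sigma>) * ?df) / ((2 * y + \<sigma>) * (2 * y + \<sigma> + 1))"
    by (simp only: times_divide_eq_left mult.assoc)
  also have "\<dots> = of_nat (Suc k) * (F * (y + \<sigma> + of_nat k)) * quad_fact y \<sigma> k / (2 * y + \<sigma>)"
    unfolding quad_fact_fwd_diff by (rule cancel[OF nz(2)])
  finally have f: "?f * ?df = \<dots>" .
  have "?b * ?db = G * (y * ?db) / ((2 * y + \<sigma>) * (2 * y + \<sigma> - 1))"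
    by (simp only: times_divide_eq_left mult.assoc mult.commute[of "2 * y + \<sigma> - 1"])
  also have "\<dots> = of_nat (Suc k) * (G * (y - of_nat k)) * quad_fact y \<sigma> k / (2 * y + \<sigma>)"
    unfolding quad_fact_bwd_diff by (rule cancel[OF nz(3)])
  finally have b: "?b * ?db = \<dots>" .
  show ?thesis
    unfolding f b add_divide_distrib[symmetric] distrib_right[symmetric] distrib_left[symmetric] E
    using nz by simp
qed

section \<open>Factorial bases in \<open>\<lambda>\<close>\<close>

text \<open>
  With \<open>s = \<alpha> + \<beta> + 1\<close>, the \<open>i\<close>-th factor at \<open>\<lambda>(x)\<close> is \<open>(x + \<delta> - i) (x + s - \<delta> + i)\<close>.
\<close>

definition lam_basis :: "real \<Rightarrow> real \<Rightarrow> nat \<Rightarrow> real poly" where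
  "lam_basis s \<delta> k = (\<Prod>i<k. [: \<delta> * (s - \<delta>) - real i * (s - 2 * \<delta> + real i), 1 :])"

lemma lam_basis_Suc:
  "lam_basis s \<delta> (Suc k) = lam_basis s \<delta> k * [: \<delta> * (s - \<delta>) - real k * (s - 2 * \<delta> + real k), 1 :]"
  by (simp add: lam_basis_def)

lemma degree_lam_basis: "degree (lam_basis s \<delta> k) = k"
  and lead_coeff_lam_basis: "coeff (lam_basis s \<delta> k) k = 1"
proof -
  have "degree (lam_basis s \<delta> k) = k \<and> coeff (lam_basis s \<delta> k) k = 1"
  proof (induction k)
    case 0
    show ?case by (simp add: lam_basis_def)
  next
    case (Suc k)
    then have "lam_basis s \<delta> k \<noteq> 0"
      by auto
    then have "degree (lam_basis s \<delta> (Suc k)) = Suc k"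
      using Suc unfolding lam_basis_Suc by (subst degree_mult_eq) auto
    moreover have "coeff (lam_basis s \<delta> (Suc k)) (Suc k) = 1"
      using Suc unfolding lam_basis_Suc by (simp add: coeff_eq_0)
    ultimately show ?case ..
  qed
  then show "degree (lam_basis s \<delta> k) = k" "coeff (lam_basis s \<delta> k) k = 1"
    by simp_all
qed

lemma shift_lam_basis:
  "shift \<alpha> \<beta> j (lam_basis (\<alpha> + \<beta> + 1) \<delta> k) =
     quad_fact (rx + rconst (of_int j) + rconst \<delta>) (rconst (\<alpha> + \<beta> + 1 - 2 * \<delta>)) k"
proof (induction k)
  case 0
  show ?case
    by (simp add: lam_basis_def shift_1)
next
  case (Suc k)
  show ?case
    unfolding lam_basis_Suc shift_mult Suc quad_fact_Suc shift_linear_factor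
    by (simp only: rconst_simps rconst_of_nat mult_2[where 'a=real] mult_2[where 'a="real poly fract"])
       (simp add: algebra_simps)
qed

lemma second_order_op_lam_basis_0: "second_order_op \<alpha> \<beta> A B (lam_basis s \<delta> 0) = 0"
  by (simp add: second_order_op_def fwd_diff_def bwd_diff_def lam_basis_def shift_1)

lemma second_order_op_lam_basis_Suc:
  assumes "F * (rx + rconst (\<alpha> + \<beta> + 1 - \<delta> + real k)) + G * (rx + rconst (\<delta> - real k)) =
      (2 * rx + rconst (\<alpha> + \<beta> + 1)) * E"
  shows "second_order_op \<alpha> \<beta>
      ((F * (rx + rconst (\<alpha> + \<beta> + 1 - \<delta>))) /
        ((2 * rx + rconst (\<alpha> + \<beta> + 1)) * (2 * rx + rconst (\<alpha> + \<beta> + 2))))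
      ((G * (rx + rconst \<delta>)) / ((2 * rx + rconst (\<alpha> + \<beta>)) * (2 * rx + rconst (\<alpha> + \<beta> + 1))))
      (lam_basis (\<alpha> + \<beta> + 1) \<delta> (Suc k)) =
    rconst (real (Suc k)) * E * shift \<alpha> \<beta> 0 (lam_basis (\<alpha> + \<beta> + 1) \<delta> k)"
proof -
  define y where "y = rx + rconst \<delta>"
  define \<sigma> where "\<sigma> = rconst (\<alpha> + \<beta> + 1 - 2 * \<delta>)"
  have eqs: "2 * rx + rconst (\<alpha> + \<beta> + 1) = 2 * y + \<sigma>"
    "2 * rx + rconst (\<alpha> + \<beta> + 2) = 2 * y + \<sigma> + 1"
    "2 * rx + rconst (\<alpha> + \<beta>) = 2 * y + \<sigma> - 1"
    "rx + rconst (\<alpha> + \<beta> + 1 - \<delta>) = y + \<sigma>"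
    by (simp_all add: y_def \<sigma>_def rconst_simps algebra_simps)
  have E: "F * (y + \<sigma> + of_nat k) + G * (y - of_nat k) = (2 * y + \<sigma>) * E"
    proof -
    have "y + \<sigma> + of_nat k = rx + rconst (\<alpha> + \<beta> + 1 - \<delta> + real k)"
      "y - of_nat k = rx + rconst (\<delta> - real k)"
      by (simp_all add: y_def \<sigma>_def rconst_simps algebra_simps)
    then show ?thesis
      using assms by (simp only: eqs(1))
  qed
  have "shift \<alpha> \<beta> j (lam_basis (\<alpha> + \<beta> + 1) \<delta> n) = quad_fact (y + rconst (of_int j)) \<sigma> n" for j n
    unfolding shift_lam_basis y_def \<sigma>_def by (simp only: ac_simps)
  then have sh: "shift \<alpha> \<beta> 0 (lam_basis (\<alpha> + \<beta> + 1) \<delta> n) = quad_fact y \<sigma> n"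
    "shift \<alpha> \<beta> 1 (lam_basis (\<alpha> + \<beta> + 1) \<delta> n) = quad_fact (y + 1) \<sigma> n"
    "shift \<alpha> \<beta> (-1) (lam_basis (\<alpha> + \<beta> + 1) \<delta> n) = quad_fact (y - 1) \<sigma> n" for n
    by (simp_all add: rconst_simps)
  have nz: "2 * y + \<sigma> \<noteq> 0" "2 * y + \<sigma> + 1 \<noteq> 0" "2 * y + \<sigma> - 1 \<noteq> 0"
    using two_rx_plus_rconst_nonzero[of "\<alpha> + \<beta> + 1"] two_rx_plus_rconst_nonzero[of "\<alpha> + \<beta> + 2"]
      two_rx_plus_rconst_nonzero[of "\<alpha> + \<beta>"] unfolding eqs by simp_all
  show ?thesis
    unfolding second_order_op_def fwd_diff_def bwd_diff_def eqs sh y_def[symmetric] rconst_of_nat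
    by (rule quad_fact_second_order[OF nz E])
qed

section \<open>Coefficients of the dual Hahn polynomials\<close>

text \<open>
  For \<open>k \<le> n\<close> this is \<open>(-1)\<^bsup>n-k\<^esup>\<close> times the binomial coefficient of \<open>M - k\<close> over \<open>n - k\<close>. The value
  \<open>0\<close> for \<open>k > n\<close> lets the rules below hold at \<open>k = n\<close> and sums over \<open>k \<le> n\<close> keep their range.
\<close>

definition basis_coeff :: "real \<Rightarrow> nat \<Rightarrow> nat \<Rightarrow> real" where
  "basis_coeff M n k = (if k \<le> n then pochhammer (real k - M) (n - k) / fact (n - k) else 0)"

lemma basis_coeff_diag [simp]: "basis_coeff M n n = 1" "basis_coeff M n (Suc n) = 0"
  by (simp_all add: basis_coeff_def)

lemma basis_coeff_lower:
  assumes "k \<le> n"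
  shows "real (n - k) * basis_coeff M n k = (real k - M) * basis_coeff M n (Suc k)"
proof (cases "k = n")
  case False
  then obtain m where "n = Suc (k + m)"
    using assms less_imp_Suc_add[of k n] by auto
  then show ?thesis
    by (simp add: basis_coeff_def pochhammer_rec Suc_diff_le field_simps del: of_nat_Suc)
       (simp add: algebra_simps)
qed simp

lemma basis_coeff_raise:
  assumes "k \<le> n"
  shows "real (n - k) * basis_coeff M (Suc n) (Suc k) = (real n - M) * basis_coeff M n (Suc k)"
proof (cases "k = n")
  case False
  then obtain m where "n = Suc (k + m)"
    using assms less_imp_Suc_add[of k n] by auto
  then show ?thesis
    by (simp add: basis_coeff_def pochhammer_Suc field_simps del: of_nat_Suc)
       (simp add: algebra_simps)
qed simp

lemma basis_coeff_pascal:
  assumes "k \<le> n"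
  shows "basis_coeff M (Suc n) (Suc k) = basis_coeff M n k + basis_coeff M n (Suc k)"
proof (cases "k = n")
  case False
  then have "real (n - k) \<noteq> 0"
    using assms by simp
  moreover have "real (n - k) * basis_coeff M (Suc n) (Suc k) =
      real (n - k) * (basis_coeff M n k + basis_coeff M n (Suc k))"
    unfolding ring_distribs basis_coeff_lower[OF assms] basis_coeff_raise[OF assms]
    using assms by (simp add: of_nat_diff algebra_simps)
  ultimately show ?thesis
    by (metis mult_left_cancel)
qed simp

text \<open>
  When \<open>k < n\<close>, \<open>basis_coeff_lower\<close> and \<open>basis_coeff_raise\<close> make all three coefficients multiples of
  \<open>basis_coeff M n (Suc k)\<close>, which leaves a polynomial identity in the parameters.
\<close>

lemma basis_coeff_weighted_pascal:
  assumes "k \<le> n"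
  shows "(\<alpha> + real n + 1) * (M - real k) * basis_coeff M (Suc n) (Suc k) =
    (M - real n) * ((\<alpha> + real k + 1) * basis_coeff M n k - (M - real k) * basis_coeff M n (Suc k))"
proof (cases "k = n")
  case False
  then have nz: "real (n - k) \<noteq> 0"
    using assms by simp
  have "real (n - k) * ((\<alpha> + real n + 1) * (M - real k) * basis_coeff M (Suc n) (Suc k)) =
      (\<alpha> + real n + 1) * (M - real k) * (real (n - k) * basis_coeff M (Suc n) (Suc k))"
    by (simp only: ac_simps)
  also have "\<dots> = (M - real n) * ((\<alpha> + real k + 1) * ((real k - M) * basis_coeff M n (Suc k))
      - real (n - k) * ((M - real k) * basis_coeff M n (Suc k)))"
    unfolding basis_coeff_raise[OF assms] using assms by (simp add: of_nat_diff algebra_simps)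
  also have "\<dots> = real (n - k) * ((M - real n) *
      ((\<alpha> + real k + 1) * basis_coeff M n k - (M - real k) * basis_coeff M n (Suc k)))"
    unfolding basis_coeff_lower[OF assms, symmetric] by (simp add: algebra_simps)
  finally show ?thesis
    using nz by (metis mult_left_cancel)
qed simp

text \<open>
  Dividing the basis by this weight absorbs a factor \<open>k (\<alpha> + k)\<close> whenever an operator lowers the
  index \<open>k\<close>, which turns the coefficients of the polynomials into generalised binomial coefficients.
\<close>

definition basis_weight :: "real \<Rightarrow> nat \<Rightarrow> real" where
  "basis_weight \<alpha> k = pochhammer (\<alpha> + 1) k * fact k"

lemma basis_weight_Suc:
  "basis_weight \<alpha> (Suc k) = basis_weight \<alpha> k * (real (Suc k) * (\<alpha> + real (Suc k)))"
  by (simp add: basis_weight_def pochhammer_Suc algebra_simps)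

lemma not_negative_integer_imp_nonzero:
  assumes "\<forall>k::nat. 1 \<le> k \<longrightarrow> \<alpha> \<noteq> - real k"
  shows "\<alpha> + real (Suc k) \<noteq> 0"
  using assms[rule_format, of "Suc k"] by (simp add: add_eq_0_iff2)

lemma basis_weight_nonzero:
  assumes "\<forall>k::nat. 1 \<le> k \<longrightarrow> \<alpha> \<noteq> - real k"
  shows "basis_weight \<alpha> k \<noteq> 0"
proof (induction k)
  case (Suc k)
  then show ?case
    using not_negative_integer_imp_nonzero[OF assms, of k]
    by (simp add: basis_weight_Suc del: of_nat_Suc) 
qed (simp add: basis_weight_def)

definition hahn_expansion :: "real \<Rightarrow> real \<Rightarrow> real \<Rightarrow> real \<Rightarrow> nat \<Rightarrow> real poly" where
  "hahn_expansion \<alpha> \<beta> N \<delta> n = (\<Sum>k\<le>n. smult (basis_coeff (N + \<delta>) n k / basis_weight \<alpha> k)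
     (lam_basis (\<alpha> + \<beta> + 1) \<delta> k))"

lemma dual_hahn_eq_hahn_expansion: "dual_hahn \<alpha> \<beta> N = hahn_expansion \<alpha> \<beta> N 0"
proof
  fix n
  have "(-1) ^ j * pochhammer (- real n) j = fact n / fact (n - j)" if "j \<le> n" for j
  proof -
    have "fact n = fact (n - j) * pochhammer (real (n - j) + 1) j"
      using that pochhammer_product[of "n - j" n "1 :: real"]
      by (simp add: pochhammer_fact add.commute)
    then show ?thesis
      using that by (simp add: pochhammer_minus of_nat_diff flip: power_mult_distrib mult.assoc)
  qed
  then have "1 / fact n * ((-1) ^ j * pochhammer (- real n) j * pochhammer (- N + real j) (n - j)
      / (pochhammer (\<alpha> + 1) j * fact j)) = basis_coeff (N + 0) n j / basis_weight \<alpha> j"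
    if "j \<le> n" for j
    using that by (simp add: basis_coeff_def basis_weight_def)
  then show "dual_hahn \<alpha> \<beta> N n = hahn_expansion \<alpha> \<beta> N 0 n"
    unfolding dual_hahn_def hahn_expansion_def smult_sum_right atLeast0AtMost
    by (intro sum.cong refl) (simp add: lam_basis_def)
qed

lemma coeff_hahn_expansion:
  assumes "n \<le> m"
  shows "coeff (hahn_expansion \<alpha> \<beta> N \<delta> n) m = (if m = n then 1 / basis_weight \<alpha> n else 0)"
proof -
  have "coeff (lam_basis (\<alpha> + \<beta> + 1) \<delta> k) m = (if k = m then 1 else 0)" if "k \<le> n" for k
    using that assms lead_coeff_lam_basis by (auto intro!: coeff_eq_0 simp: degree_lam_basis)
  then have "coeff (hahn_expansion \<alpha> \<beta> N \<delta> n) m =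
      (\<Sum>k\<le>n. if k = m then basis_coeff (N + \<delta>) n k / basis_weight \<alpha> k else 0)"
    unfolding hahn_expansion_def coeff_sum by (intro sum.cong refl) simp
  also have "\<dots> = (if m = n then 1 / basis_weight \<alpha> n else 0)"
    using assms by (auto simp: sum.delta)
  finally show ?thesis .
qed

lemma degree_hahn_expansion:
  assumes "\<forall>k::nat. 1 \<le> k \<longrightarrow> \<alpha> \<noteq> - real k"
  shows "degree (hahn_expansion \<alpha> \<beta> N \<delta> n) = n"
proof (rule antisym)
  show "degree (hahn_expansion \<alpha> \<beta> N \<delta> n) \<le> n"
    by (intro degree_le) (simp add: coeff_hahn_expansion)
  show "n \<le> degree (hahn_expansion \<alpha> \<beta> N \<delta> n)"
    using basis_weight_nonzero[OF assms] by (intro le_degree) (simp add: coeff_hahn_expansion)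
qed

section \<open>Bidiagonal operators on the expansions\<close>

text \<open>
  On the basis divided by its weight the operator is bidiagonal with entries \<open>a k\<close> and \<open>e (k - 1)\<close>, so
  coefficient \<open>k\<close> of the image collects one term from \<open>k\<close> and one from \<open>Suc k\<close>.
\<close>

lemma bidiagonal_on_hahn_expansion:
  assumes alpha: "\<forall>k::nat. 1 \<le> k \<longrightarrow> \<alpha> \<noteq> - real k"
    and D: "Vector_Spaces.linear smult smult D"
    and act: "\<And>k. D (lam_basis (\<alpha> + \<beta> + 1) \<delta> k) =
      smult (a k) (lam_basis (\<alpha> + \<beta> + 1) \<delta> k) +
      smult (real k * (\<alpha> + real k) * e (k - 1)) (lam_basis (\<alpha> + \<beta> + 1) \<delta> (k - 1))"
  shows "D (hahn_expansion \<alpha> \<beta> N \<delta> n) =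
    (\<Sum>k\<le>n. smult ((a k * basis_coeff (N + \<delta>) n k + e k * basis_coeff (N + \<delta>) n (Suc k))
        / basis_weight \<alpha> k) (lam_basis (\<alpha> + \<beta> + 1) \<delta> k))"
proof -
  let ?c = "basis_coeff (N + \<delta>) n" and ?w = "basis_weight \<alpha>" and ?U = "lam_basis (\<alpha> + \<beta> + 1) \<delta>"
  let ?g = "\<lambda>k. smult (?c k / ?w k * (real k * (\<alpha> + real k) * e (k - 1))) (?U (k - 1))"
  \<comment> \<open>The lowered terms are reindexed; the one that would come from \<open>k = Suc n\<close> has coefficient \<open>0\<close>,
    and the one for \<open>k = 0\<close> vanishes because of the factor \<open>real k\<close>.\<close>
  have "?g (Suc k) = smult (e k * ?c (Suc k) / ?w k) (?U k)" for k
    using not_negative_integer_imp_nonzero[OF alpha, of k]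
    by (simp add: basis_weight_Suc mult.commute del: of_nat_Suc)
  then have "(\<Sum>k\<le>n. smult (e k * ?c (Suc k) / ?w k) (?U k)) = (\<Sum>k\<le>Suc n. ?g k)"
    by (simp add: sum.atMost_Suc_shift del: sum.atMost_Suc of_nat_Suc)
  also have "\<dots> = (\<Sum>k\<le>n. ?g k)"
    by simp
  finally have lower: "(\<Sum>k\<le>n. smult (e k * ?c (Suc k) / ?w k) (?U k)) = (\<Sum>k\<le>n. ?g k)" .
  have "D (hahn_expansion \<alpha> \<beta> N \<delta> n) =
      (\<Sum>k\<le>n. smult (a k * ?c k / ?w k) (?U k)) + (\<Sum>k\<le>n. ?g k)"
    unfolding hahn_expansion_def linear_smult_sum[OF D] act sum.distrib[symmetric]
    by (intro sum.cong refl) (simp add: smult_add_right mult_ac)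
  also have "\<dots> = (\<Sum>k\<le>n. smult ((a k * ?c k + e k * ?c (Suc k)) / ?w k) (?U k))"
    unfolding lower[symmetric] sum.distrib[symmetric] by (simp add: add_divide_distrib smult_add_left)
  finally show ?thesis .
qed

text \<open>
  The recurrence between consecutive expansions is compared coefficient by coefficient.
\<close>

lemma lowering_is_eps_operator:
  assumes alpha: "\<forall>k::nat. 1 \<le> k \<longrightarrow> \<alpha> \<noteq> - real k"
    and D: "Vector_Spaces.linear smult smult D"
    and act: "\<And>k. D (lam_basis (\<alpha> + \<beta> + 1) \<delta> k) =
      smult (real k * (\<alpha> + real k) * e (k - 1)) (lam_basis (\<alpha> + \<beta> + 1) \<delta> (k - 1))"
    and rec: "\<And>n k. k \<le> n \<Longrightarrow> e k * basis_coeff (N + \<delta>) (Suc n) (Suc k) =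
      \<epsilon> (Suc n) * (basis_coeff (N + \<delta>) n k - e k * basis_coeff (N + \<delta>) n (Suc k))"
  shows "is_eps_operator (hahn_expansion \<alpha> \<beta> N \<delta>) \<epsilon> D"
proof (rule eps_operator_if_recurrence[OF D])
  let ?c = "basis_coeff (N + \<delta>)" and ?w = "basis_weight \<alpha>" and ?U = "lam_basis (\<alpha> + \<beta> + 1) \<delta>"
  have DR: "D (hahn_expansion \<alpha> \<beta> N \<delta> n) = (\<Sum>k\<le>n. smult (e k * ?c n (Suc k) / ?w k) (?U k))" for n
    using bidiagonal_on_hahn_expansion[OF alpha D, of \<beta> \<delta> "\<lambda>_. 0" e N n] act by simp
  show "D (hahn_expansion \<alpha> \<beta> N \<delta> 0) = 0"
    by (simp add: DR)
  show "D (hahn_expansion \<alpha> \<beta> N \<delta> (Suc n)) =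
      smult (\<epsilon> (Suc n)) (hahn_expansion \<alpha> \<beta> N \<delta> n - D (hahn_expansion \<alpha> \<beta> N \<delta> n))" for n
  proof -
    have "D (hahn_expansion \<alpha> \<beta> N \<delta> (Suc n)) =
        (\<Sum>k\<le>n. smult (e k * ?c (Suc n) (Suc k) / ?w k) (?U k))"
      by (simp add: DR)
    also have "\<dots> = (\<Sum>k\<le>n. smult (\<epsilon> (Suc n))
        (smult (?c n k / ?w k) (?U k) - smult (e k * ?c n (Suc k) / ?w k) (?U k)))"
      by (intro sum.cong refl) (simp add: rec diff_divide_distrib right_diff_distrib mult.assoc flip: smult_diff_left)
    finally show ?thesis
      unfolding DR by (simp only: hahn_expansion_def sum_subtractf smult_sum_right[symmetric])
  qed
qed

section \<open>The second order operator and the symmetry of the expansions\<close>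

definition dual_hahn_op :: "real \<Rightarrow> real \<Rightarrow> real \<Rightarrow> real poly \<Rightarrow> real poly fract" where
  "dual_hahn_op \<alpha> \<beta> N = second_order_op \<alpha> \<beta>
     (- ((rx + rconst (\<alpha> + 1)) * (rx + rconst (\<alpha> + \<beta> + 1)) * (rconst N - rx)) /
        ((2 * rx + rconst (\<alpha> + \<beta> + 1)) * (2 * rx + rconst (\<alpha> + \<beta> + 2))))
     ((rx * (rx + rconst \<beta>) * (rx + rconst (\<alpha> + \<beta> + N + 1))) /
        ((2 * rx + rconst (\<alpha> + \<beta>)) * (2 * rx + rconst (\<alpha> + \<beta> + 1))))"

definition dual_hahn_op_image :: "real \<Rightarrow> real \<Rightarrow> real \<Rightarrow> real \<Rightarrow> nat \<Rightarrow> real poly" where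
  "dual_hahn_op_image \<alpha> \<beta> N \<delta> k =
     smult (real k) (lam_basis (\<alpha> + \<beta> + 1) \<delta> k) +
     smult (real k * (\<alpha> + real k) * (real (k - 1) - (N + \<delta>))) (lam_basis (\<alpha> + \<beta> + 1) \<delta> (k - 1))"

text \<open>
  The forward coefficient contains both \<open>x + \<alpha> + \<beta> + 1\<close> and \<open>x + \<alpha> + 1\<close>, the factors
  \<open>x + s - \<delta>\<close> needed for \<open>\<delta> = 0\<close> and for \<open>\<delta> = \<beta>\<close>; likewise \<open>x\<close> and \<open>x + \<beta>\<close> in the backward
  coefficient. This is why one operator is bidiagonal in both bases.
\<close>

lemma dual_hahn_op_lam_basis:
  assumes "\<delta> = 0 \<or> \<delta> = \<beta>"
  shows "dual_hahn_op \<alpha> \<beta> N (lam_basis (\<alpha> + \<beta> + 1) \<delta> k) =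
     shift \<alpha> \<beta> 0 (dual_hahn_op_image \<alpha> \<beta> N \<delta> k)"
proof (cases k)
  case 0
  then show ?thesis
    by (simp add: dual_hahn_op_def dual_hahn_op_image_def second_order_op_lam_basis_0)
       (simp add: shift_def)
next
  case (Suc m)
  \<comment> \<open>For either value of \<open>\<delta>\<close>, \<open>F\<close> and \<open>G\<close> are the numerators without the factors
    \<open>x + s - \<delta>\<close> and \<open>x + \<delta>\<close> that the differences of the basis absorb.\<close>
  define F where "F = - ((rx + rconst (\<alpha> + 1 + \<delta>)) * (rconst N - rx))"
  define G where "G = (rx + rconst (\<beta> - \<delta>)) * (rx + rconst (\<alpha> + \<beta> + N + 1))"
  \<comment> \<open>\<open>\<lambda>(x) + c\<close> is the factor by which the basis grows from \<open>m\<close> to \<open>Suc m\<close>, so multiplying by \<open>E\<close>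
    gives one term of index \<open>Suc m\<close> and one of index \<open>m\<close>.\<close>
  define c where "c = \<delta> * (\<alpha> + \<beta> + 1 - \<delta>) - real m * (\<alpha> + \<beta> + 1 - 2 * \<delta> + real m)"
  define E where "E = rx * (rx + rconst (\<alpha> + \<beta> + 1)) + rconst c +
    rconst ((\<alpha> + real (Suc m)) * (real m - (N + \<delta>)))"
  have op: "dual_hahn_op \<alpha> \<beta> N = second_order_op \<alpha> \<beta>
      ((F * (rx + rconst (\<alpha> + \<beta> + 1 - \<delta>))) /
        ((2 * rx + rconst (\<alpha> + \<beta> + 1)) * (2 * rx + rconst (\<alpha> + \<beta> + 2))))
      ((G * (rx + rconst \<delta>)) /
        ((2 * rx + rconst (\<alpha> + \<beta>)) * (2 * rx + rconst (\<alpha> + \<beta> + 1))))"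
    using assms by (auto simp: dual_hahn_op_def F_def G_def ac_simps rconst_simps(5))
  have E: "F * (rx + rconst (\<alpha> + \<beta> + 1 - \<delta> + real m)) + G * (rx + rconst (\<delta> - real m)) =
      (2 * rx + rconst (\<alpha> + \<beta> + 1)) * E"
    unfolding E_def F_def G_def c_def using assms
    by (auto simp: rconst_simps algebra_simps)
  have "shift \<alpha> \<beta> 0 (dual_hahn_op_image \<alpha> \<beta> N \<delta> k) =
      rconst (real (Suc m)) * E * shift \<alpha> \<beta> 0 (lam_basis (\<alpha> + \<beta> + 1) \<delta> m)"
    unfolding dual_hahn_op_image_def Suc shift_add shift_smult lam_basis_Suc shift_mult
      shift_linear_factor c_def[symmetric] E_def
    by (simp add: rconst_simps algebra_simps)
  then show ?thesis
    unfolding op Suc second_order_op_lam_basis_Suc[OF E] by simp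
qed

lemma dual_hahn_op_eigenfunctions:
  assumes alpha: "\<forall>k::nat. 1 \<le> k \<longrightarrow> \<alpha> \<noteq> - real k"
  obtains L where "Vector_Spaces.linear smult smult L"
    and "\<And>q. shift \<alpha> \<beta> 0 (L q) = dual_hahn_op \<alpha> \<beta> N q"
    and "\<And>k. L (lam_basis (\<alpha> + \<beta> + 1) 0 k) = dual_hahn_op_image \<alpha> \<beta> N 0 k"
    and "\<And>\<delta> n. \<delta> = 0 \<or> \<delta> = \<beta> \<Longrightarrow>
      L (hahn_expansion \<alpha> \<beta> N \<delta> n) = smult (real n) (hahn_expansion \<alpha> \<beta> N \<delta> n)"
proof -
  obtain L where L: "Vector_Spaces.linear smult smult L"
    and sh: "\<And>q. shift \<alpha> \<beta> 0 (L q) = dual_hahn_op \<alpha> \<beta> N q"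
    and act0: "\<And>k. L (lam_basis (\<alpha> + \<beta> + 1) 0 k) = dual_hahn_op_image \<alpha> \<beta> N 0 k"
    using second_order_op_descends[where p = "lam_basis (\<alpha> + \<beta> + 1) 0"
        and f = "dual_hahn_op_image \<alpha> \<beta> N 0", OF degree_lam_basis]
      dual_hahn_op_lam_basis[of 0 \<beta> \<alpha> N] unfolding dual_hahn_op_def
    by (metis lead_coeff_lam_basis one_neq_zero)
  have eig: "L (hahn_expansion \<alpha> \<beta> N \<delta> n) = smult (real n) (hahn_expansion \<alpha> \<beta> N \<delta> n)"
    if \<delta>: "\<delta> = 0 \<or> \<delta> = \<beta>" for \<delta> n
  proof -
    have act: "L (lam_basis (\<alpha> + \<beta> + 1) \<delta> k) = dual_hahn_op_image \<alpha> \<beta> N \<delta> k" for k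
      using sh[of "lam_basis (\<alpha> + \<beta> + 1) \<delta> k"] dual_hahn_op_lam_basis[OF \<delta>]
      by (simp add: shift_0_inject)
    have "real k * basis_coeff (N + \<delta>) n k + (real k - (N + \<delta>)) * basis_coeff (N + \<delta>) n (Suc k) =
        real n * basis_coeff (N + \<delta>) n k" if "k \<le> n" for k
      using that unfolding basis_coeff_lower[OF that, symmetric]
      by (simp add: of_nat_diff algebra_simps)
    then show ?thesis
      using bidiagonal_on_hahn_expansion[OF alpha L, of \<beta> \<delta> real "\<lambda>k. real k - (N + \<delta>)" N n]
        act by (simp add: dual_hahn_op_image_def hahn_expansion_def smult_sum_right)
  qed
  show ?thesis
    using that[OF L sh act0 eig] .
qed

lemma dual_hahn_op_in_diff_algebra:
  assumes alpha: "\<forall>k::nat. 1 \<le> k \<longrightarrow> \<alpha> \<noteq> - real k"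
  shows "\<exists>L \<in> diff_algebra \<alpha> \<beta>. \<forall>n. L (hahn_expansion \<alpha> \<beta> N 0 n) =
    rconst (real n) * shift \<alpha> \<beta> 0 (hahn_expansion \<alpha> \<beta> N 0 n)"
proof -
  obtain L where sh: "\<And>q. shift \<alpha> \<beta> 0 (L q) = dual_hahn_op \<alpha> \<beta> N q"
    and eig: "\<And>\<delta> n. \<delta> = 0 \<or> \<delta> = \<beta> \<Longrightarrow>
      L (hahn_expansion \<alpha> \<beta> N \<delta> n) = smult (real n) (hahn_expansion \<alpha> \<beta> N \<delta> n)"
    using dual_hahn_op_eigenfunctions[OF alpha, of \<beta> N] by metis
  then show ?thesis
    by (intro bexI[of _ "\<lambda>q. shift \<alpha> \<beta> 0 (L q)"]
        second_order_op_in_diff_algebra[OF sh[unfolded dual_hahn_op_def]])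
       (simp add: shift_smult)
qed

text \<open>
  On polynomials of degree at most \<open>m\<close> the operator multiplies the coefficient of degree \<open>m\<close> by \<open>m\<close>.
  The difference of the two expansions has eigenvalue \<open>n\<close> and no term of degree \<open>n\<close> or more, hence
  vanishes.
\<close>

lemma hahn_expansion_symmetric:
  assumes alpha: "\<forall>k::nat. 1 \<le> k \<longrightarrow> \<alpha> \<noteq> - real k"
  shows "hahn_expansion \<alpha> \<beta> N 0 = hahn_expansion \<alpha> \<beta> N \<beta>"
proof
  fix n
  obtain L where L: "Vector_Spaces.linear smult smult L"
    and act: "\<And>k. L (lam_basis (\<alpha> + \<beta> + 1) 0 k) = dual_hahn_op_image \<alpha> \<beta> N 0 k"
    and eig: "\<And>\<delta> n. \<delta> = 0 \<or> \<delta> = \<beta> \<Longrightarrow>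
      L (hahn_expansion \<alpha> \<beta> N \<delta> n) = smult (real n) (hahn_expansion \<alpha> \<beta> N \<delta> n)"
    using dual_hahn_op_eigenfunctions[OF alpha, of \<beta> N] by metis
  have add: "L (q + r) = L q + L r" and smult: "L (smult c q) = smult c (L q)" for c q r
    using L by (simp_all add: linear_smult_iff)
  have top: "coeff (L q) m = real m * coeff q m" if "degree q \<le> m" for q m
  proof (rule degree_basis_induct[where P = "\<lambda>q. coeff (L q) m = real m * coeff q m"
        and p = "lam_basis (\<alpha> + \<beta> + 1) 0", OF degree_lam_basis _ _ _ _ that])
    fix k
    show "coeff (lam_basis (\<alpha> + \<beta> + 1) 0 k) k \<noteq> 0"
      by (simp add: lead_coeff_lam_basis)
    assume "k \<le> m"
    then have "coeff (lam_basis (\<alpha> + \<beta> + 1) 0 (k - 1)) m = 0" if "k \<noteq> 0"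
      using that by (intro coeff_eq_0) (simp add: degree_lam_basis)
    moreover have "coeff (lam_basis (\<alpha> + \<beta> + 1) 0 k) m = 0" if "k \<noteq> m"
      using that \<open>k \<le> m\<close> by (intro coeff_eq_0) (simp add: degree_lam_basis)
    ultimately show "coeff (L (lam_basis (\<alpha> + \<beta> + 1) 0 k)) m =
        real m * coeff (lam_basis (\<alpha> + \<beta> + 1) 0 k) m"
      by (cases "k = m"; cases "k = 0") (simp_all add: act dual_hahn_op_image_def)
  qed (simp_all add: add smult algebra_simps)
  define q where "q = hahn_expansion \<alpha> \<beta> N 0 n - hahn_expansion \<alpha> \<beta> N \<beta> n"
  have "L (hahn_expansion \<alpha> \<beta> N 0 n) = L q + L (hahn_expansion \<alpha> \<beta> N \<beta> n)"
    unfolding add[symmetric] by (simp add: q_def)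
  then have Lq: "L q = smult (real n) q"
    using eig[of 0 n] eig[of \<beta> n] by (simp add: q_def smult_diff_right)
  have "degree q \<noteq> n \<or> q = 0"
  proof -
    have "coeff q n = 0"
      by (simp add: q_def coeff_hahn_expansion)
    then show ?thesis
      using leading_coeff_0_iff by blast
  qed
  moreover have "real n * lead_coeff q = real (degree q) * lead_coeff q"
    using top[of q "degree q"] by (simp add: Lq)
  ultimately have "q = 0"
    by auto
  then show "hahn_expansion \<alpha> \<beta> N 0 n = hahn_expansion \<alpha> \<beta> N \<beta> n"
    by (simp add: q_def)
qed

section \<open>The three operators\<close>

lemma lowering_operator_exists:
  assumes alpha: "\<forall>k::nat. 1 \<le> k \<longrightarrow> \<alpha> \<noteq> - real k"
    and FG: "\<And>k. F * (rx + rconst (\<alpha> + \<beta> + 1 - \<delta> + real k)) + G * (rx + rconst (\<delta> - real k)) =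
      (2 * rx + rconst (\<alpha> + \<beta> + 1)) * rconst ((\<alpha> + real k + 1) * e k)"
    and rec: "\<And>n k. k \<le> n \<Longrightarrow> e k * basis_coeff (N + \<delta>) (Suc n) (Suc k) =
      \<epsilon> (Suc n) * (basis_coeff (N + \<delta>) n k - e k * basis_coeff (N + \<delta>) n (Suc k))"
  shows "\<exists>D. is_eps_operator (hahn_expansion \<alpha> \<beta> N \<delta>) \<epsilon> D \<and>
    (\<forall>q. shift \<alpha> \<beta> 0 (D q) = second_order_op \<alpha> \<beta>
      ((F * (rx + rconst (\<alpha> + \<beta> + 1 - \<delta>))) /
        ((2 * rx + rconst (\<alpha> + \<beta> + 1)) * (2 * rx + rconst (\<alpha> + \<beta> + 2))))
      ((G * (rx + rconst \<delta>)) / ((2 * rx + rconst (\<alpha> + \<beta>)) * (2 * rx + rconst (\<alpha> + \<beta> + 1)))) q)"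
    (is "\<exists>D. _ \<and> (\<forall>q. _ = second_order_op \<alpha> \<beta> ?A ?B q)")
proof -
  let ?U = "lam_basis (\<alpha> + \<beta> + 1) \<delta>"
  let ?f = "\<lambda>k. smult (real k * (\<alpha> + real k) * e (k - 1)) (?U (k - 1))"
  have "second_order_op \<alpha> \<beta> ?A ?B (?U k) = shift \<alpha> \<beta> 0 (?f k)" for k
  proof (cases k)
    case 0
    then show ?thesis
      by (simp add: second_order_op_lam_basis_0) (simp add: shift_def)
  next
    case (Suc m)
    then show ?thesis
      unfolding Suc second_order_op_lam_basis_Suc[OF FG]
      by (simp add: shift_smult rconst_simps algebra_simps)
  qed
  then obtain D where D: "Vector_Spaces.linear smult smult D"
    and "\<And>q. shift \<alpha> \<beta> 0 (D q) = second_order_op \<alpha> \<beta> ?A ?B q"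
    and "\<And>k. D (?U k) = ?f k"
    using second_order_op_descends[where p = ?U and f = ?f, OF degree_lam_basis]
    by (metis (no_types, lifting) lead_coeff_lam_basis one_neq_zero)
  then show ?thesis
    using lowering_is_eps_operator[OF alpha D _ rec] by blast
qed

text \<open>
  One operator with both descriptions suffices, because the dual Hahn polynomials form a basis and
  hence determine every operator of the prescribed form.
\<close>

lemma eps_operator_is_D_operator:
  assumes alpha: "\<forall>k::nat. 1 \<le> k \<longrightarrow> \<alpha> \<noteq> - real k"
    and ex: "\<exists>D. is_eps_operator (dual_hahn \<alpha> \<beta> N) \<epsilon> D \<and>
      (\<forall>q. shift \<alpha> \<beta> 0 (D q) = second_order_op \<alpha> \<beta> A B q)"
  shows "\<exists>!D. is_eps_operator (dual_hahn \<alpha> \<beta> N) \<epsilon> D"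
    and "is_eps_operator (dual_hahn \<alpha> \<beta> N) \<epsilon> D \<Longrightarrow>
      is_D_operator \<alpha> \<beta> (dual_hahn \<alpha> \<beta> N) real \<epsilon> D \<and>
      (\<forall>q. shift \<alpha> \<beta> 0 (D q) = A * fwd_diff \<alpha> \<beta> q + B * bwd_diff \<alpha> \<beta> q)"
proof -
  have deg: "degree (dual_hahn \<alpha> \<beta> N n) = n" for n
    by (simp add: dual_hahn_eq_hahn_expansion degree_hahn_expansion[OF alpha])
  have lead: "coeff (dual_hahn \<alpha> \<beta> N n) n \<noteq> 0" for n
    using basis_weight_nonzero[OF alpha, of n]
    by (simp add: dual_hahn_eq_hahn_expansion coeff_hahn_expansion)
  have unique: "D = E" if "is_eps_operator (dual_hahn \<alpha> \<beta> N) \<epsilon> D"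
    "is_eps_operator (dual_hahn \<alpha> \<beta> N) \<epsilon> E" for D E
    using that linear_eq_on_basis[of D E "dual_hahn \<alpha> \<beta> N", OF _ _ deg lead]
    by (simp add: is_eps_operator_def)
  show "\<exists>!D. is_eps_operator (dual_hahn \<alpha> \<beta> N) \<epsilon> D"
    using ex unique by blast
  assume D: "is_eps_operator (dual_hahn \<alpha> \<beta> N) \<epsilon> D"
  have sh: "shift \<alpha> \<beta> 0 (D q) = second_order_op \<alpha> \<beta> A B q" for q
    using ex unique[OF D] by blast
  show "is_D_operator \<alpha> \<beta> (dual_hahn \<alpha> \<beta> N) real \<epsilon> D \<and>
      (\<forall>q. shift \<alpha> \<beta> 0 (D q) = A * fwd_diff \<alpha> \<beta> q + B * bwd_diff \<alpha> \<beta> q)"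
    unfolding is_D_operator_def
    using deg D sh second_order_op_in_diff_algebra[OF sh] dual_hahn_op_in_diff_algebra[OF alpha]
    by (simp add: dual_hahn_eq_hahn_expansion second_order_op_def)
qed

lemma constant_eps_operator_exists:
  assumes alpha: "\<forall>k::nat. 1 \<le> k \<longrightarrow> \<alpha> \<noteq> - real k"
  shows "\<exists>D. is_eps_operator (dual_hahn \<alpha> \<beta> N) (\<lambda>n. - 1) D \<and>
    (\<forall>q. shift \<alpha> \<beta> 0 (D q) = second_order_op \<alpha> \<beta>
      (- (((rx + rconst (\<alpha> + 1)) * (rx + rconst (\<alpha> + \<beta> + 1))) /
        ((2 * rx + rconst (\<alpha> + \<beta> + 1)) * (2 * rx + rconst (\<alpha> + \<beta> + 2)))))
      ((rx * (rx + rconst \<beta>)) /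
        ((2 * rx + rconst (\<alpha> + \<beta>)) * (2 * rx + rconst (\<alpha> + \<beta> + 1)))) q)"
proof -
  have neg: "- ((a * b) / c) = (- a * b) / c" for a b c :: "real poly fract"
    by simp
  have "- (rx + rconst (\<alpha> + 1)) * (rx + rconst (\<alpha> + \<beta> + 1 - 0 + real k)) +
      (rx + rconst \<beta>) * (rx + rconst (0 - real k)) =
      (2 * rx + rconst (\<alpha> + \<beta> + 1)) * rconst ((\<alpha> + real k + 1) * - 1)" for k
    by (simp add: rconst_simps algebra_simps)
  from lowering_operator_exists[where N = N and \<epsilon> = "\<lambda>n. - 1", OF alpha this]
  show ?thesis
    unfolding neg dual_hahn_eq_hahn_expansion mult.commute[of rx "rx + rconst \<beta>"]
    by (simp add: basis_coeff_pascal rconst_simps(5) del: minus_add_distrib)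
qed

lemma falling_eps_recurrence:
  assumes alpha: "\<forall>k::nat. 1 \<le> k \<longrightarrow> \<alpha> \<noteq> - real k" and "k \<le> n"
  shows "(M - real k) / (\<alpha> + real k + 1) * basis_coeff M (Suc n) (Suc k) =
    (M - real (Suc n) + 1) / (\<alpha> + real (Suc n)) *
      (basis_coeff M n k - (M - real k) / (\<alpha> + real k + 1) * basis_coeff M n (Suc k))"
proof -
  have *: "a / k' * c = b / n' * (x - a / k' * d)"
    if "k' \<noteq> 0" "n' \<noteq> 0" "n' * a * c = b * (k' * x - a * d)" for a b c d x k' n' :: real
  proof -
    have "a / k' * c = n' * a * c / (k' * n')"
      using that(1,2) by simp
    also have "\<dots> = b * (k' * x - a * d) / (k' * n')"
      unfolding that(3) ..
    also have "\<dots> = b / n' * (x - a / k' * d)"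
      using that(1,2) by (simp add: field_simps)
    finally show ?thesis .
  qed
  show ?thesis
    using basis_coeff_weighted_pascal[OF \<open>k \<le> n\<close>, of \<alpha> M]
      not_negative_integer_imp_nonzero[OF alpha, of k] not_negative_integer_imp_nonzero[OF alpha, of n]
    by (intro *) (simp_all add: algebra_simps)
qed

text \<open>
  The second operator (\<open>\<delta> = \<beta>\<close>) and the third (\<open>\<delta> = 0\<close>) are the same construction in the two
  bases. Both lower the index with ratio \<open>e k = (N + \<delta> - k) / (\<alpha> + k + 1)\<close>; the denominator is
  compensated by the factor \<open>\<alpha> + k + 1\<close> coming from the weight.
\<close>

lemma rational_eps_operator_exists:
  assumes alpha: "\<forall>k::nat. 1 \<le> k \<longrightarrow> \<alpha> \<noteq> - real k" and \<delta>: "\<delta> = 0 \<or> \<delta> = \<beta>"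
  shows "\<exists>D. is_eps_operator (dual_hahn \<alpha> \<beta> N) (\<lambda>n. (\<delta> + N - real n + 1) / (\<alpha> + real n)) D \<and>
    (\<forall>q. shift \<alpha> \<beta> 0 (D q) = second_order_op \<alpha> \<beta>
      (((rx + rconst (\<alpha> + \<beta> + 1 - \<delta>)) * (rconst N - rx)) /
        ((2 * rx + rconst (\<alpha> + \<beta> + 1)) * (2 * rx + rconst (\<alpha> + \<beta> + 2))))
      (((rx + rconst \<delta>) * (rx + rconst (\<alpha> + \<beta> + N + 1))) /
        ((2 * rx + rconst (\<alpha> + \<beta>)) * (2 * rx + rconst (\<alpha> + \<beta> + 1)))) q)"
proof -
  have "(rconst N - rx) * (rx + rconst (\<alpha> + \<beta> + 1 - \<delta> + real k)) +
      (rx + rconst (\<alpha> + \<beta> + N + 1)) * (rx + rconst (\<delta> - real k)) =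
      (2 * rx + rconst (\<alpha> + \<beta> + 1)) *
        rconst ((\<alpha> + real k + 1) * ((N + \<delta> - real k) / (\<alpha> + real k + 1)))" for k
  proof -
    have "(\<alpha> + real k + 1) * ((N + \<delta> - real k) / (\<alpha> + real k + 1)) = N + \<delta> - real k"
      using not_negative_integer_imp_nonzero[OF alpha, of k] by (simp add: add_ac)
    then show ?thesis
      unfolding \<open>_ * (_ / _) = _\<close> by (simp add: rconst_simps algebra_simps)
  qed
  from lowering_operator_exists[where N = N and \<epsilon> = "\<lambda>n. (\<delta> + N - real n + 1) / (\<alpha> + real n)",
      OF alpha this]
  have "\<exists>D. is_eps_operator (hahn_expansion \<alpha> \<beta> N \<delta>) (\<lambda>n. (\<delta> + N - real n + 1) / (\<alpha> + real n)) D \<and>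
    (\<forall>q. shift \<alpha> \<beta> 0 (D q) = second_order_op \<alpha> \<beta>
      (((rconst N - rx) * (rx + rconst (\<alpha> + \<beta> + 1 - \<delta>))) /
        ((2 * rx + rconst (\<alpha> + \<beta> + 1)) * (2 * rx + rconst (\<alpha> + \<beta> + 2))))
      (((rx + rconst (\<alpha> + \<beta> + N + 1)) * (rx + rconst \<delta>)) /
        ((2 * rx + rconst (\<alpha> + \<beta>)) * (2 * rx + rconst (\<alpha> + \<beta> + 1)))) q)"
    using falling_eps_recurrence[OF alpha, of _ _ "N + \<delta>"] by (simp add: add.commute[of \<delta> N])
  moreover have "dual_hahn \<alpha> \<beta> N = hahn_expansion \<alpha> \<beta> N \<delta>"
    using \<delta> hahn_expansion_symmetric[OF alpha] by (auto simp: dual_hahn_eq_hahn_expansion)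
  ultimately show ?thesis
    by (simp only: mult.commute)
qed

theorem lemma4p1:
  fixes \<alpha> \<beta> N :: real
    and R :: "nat \<Rightarrow> real poly"
    and \<epsilon>1 \<epsilon>2 \<epsilon>3 :: "nat \<Rightarrow> real"
  assumes alpha: "\<forall>k::nat. 1 \<le> k \<longrightarrow> \<alpha> \<noteq> - real k"
    and R: "R = dual_hahn \<alpha> \<beta> N"
    and eps1: "\<epsilon>1 = (\<lambda>n. - 1)"
    and eps2: "\<epsilon>2 = (\<lambda>n. (\<beta> + N - real n + 1) / (\<alpha> + real n))"
    and eps3: "\<epsilon>3 = (\<lambda>n. (N - real n + 1) / (\<alpha> + real n))"
  shows
    "(\<exists>!D. is_eps_operator R \<epsilon>1 D) \<and>
     (\<exists>!D. is_eps_operator R \<epsilon>2 D) \<and>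
     (\<exists>!D. is_eps_operator R \<epsilon>3 D) \<and>
     (\<forall>D. is_eps_operator R \<epsilon>1 D \<longrightarrow>
        is_D_operator \<alpha> \<beta> R real \<epsilon>1 D \<and>
        (\<forall>q. shift \<alpha> \<beta> 0 (D q) =
           - (((rx + rconst (\<alpha> + 1)) * (rx + rconst (\<alpha> + \<beta> + 1)))
               / ((2 * rx + rconst (\<alpha> + \<beta> + 1)) * (2 * rx + rconst (\<alpha> + \<beta> + 2)))) * fwd_diff \<alpha> \<beta> q
           + (rx * (rx + rconst \<beta>))
               / ((2 * rx + rconst (\<alpha> + \<beta>)) * (2 * rx + rconst (\<alpha> + \<beta> + 1))) * bwd_diff \<alpha> \<beta> q)) \<and>
     (\<forall>D. is_eps_operator R \<epsilon>2 D \<longrightarrow>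
        is_D_operator \<alpha> \<beta> R real \<epsilon>2 D \<and>
        (\<forall>q. shift \<alpha> \<beta> 0 (D q) =
           ((rx + rconst (\<alpha> + 1)) * (rconst N - rx))
               / ((2 * rx + rconst (\<alpha> + \<beta> + 1)) * (2 * rx + rconst (\<alpha> + \<beta> + 2))) * fwd_diff \<alpha> \<beta> q
           + ((rx + rconst \<beta>) * (rx + rconst (\<alpha> + \<beta> + N + 1)))
               / ((2 * rx + rconst (\<alpha> + \<beta>)) * (2 * rx + rconst (\<alpha> + \<beta> + 1))) * bwd_diff \<alpha> \<beta> q)) \<and>
     (\<forall>D. is_eps_operator R \<epsilon>3 D \<longrightarrow>
        is_D_operator \<alpha> \<beta> R real \<epsilon>3 D \<and>
        (\<forall>q. shift \<alpha> \<beta> 0 (D q) =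
           ((rx + rconst (\<alpha> + \<beta> + 1)) * (rconst N - rx))
               / ((2 * rx + rconst (\<alpha> + \<beta> + 1)) * (2 * rx + rconst (\<alpha> + \<beta> + 2))) * fwd_diff \<alpha> \<beta> q
           + (rx * (rx + rconst (\<alpha> + \<beta> + N + 1)))
               / ((2 * rx + rconst (\<alpha> + \<beta>)) * (2 * rx + rconst (\<alpha> + \<beta> + 1))) * bwd_diff \<alpha> \<beta> q))"
proof -
  have "rconst (\<alpha> + \<beta> + 1 - \<beta>) = rconst (\<alpha> + 1)" "rx + rconst 0 = rx"
    by (simp_all add: rconst_simps)
  note eqs = this
  note D1 = eps_operator_is_D_operator[OF alpha constant_eps_operator_exists[OF alpha]]
  note D2 = eps_operator_is_D_operator[OF alpha rational_eps_operator_exists[OF alpha disjI2[OF refl[of \<beta>]]], unfolded eqs]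
  note D3 = eps_operator_is_D_operator[OF alpha rational_eps_operator_exists[OF alpha disjI1[OF refl]],
      unfolded eqs add_0_left diff_zero]
  show ?thesis
    unfolding R eps1 eps2 eps3
    by (intro conjI D1(1) D2(1) D3(1) allI[OF impI[OF D1(2)]] allI[OF impI[OF D2(2)]]
        allI[OF impI[OF D3(2)]])
qed

end
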